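(* Let $F$ and $g$ be positive integers such that $F\ge 4g-1$. The correspondence \[S\mapsto \{0\}\cup K_S(F-\operatorname{F}(S))\] is a bijection between the set of numerical semigroups with genus $g$ and the set of almost symmetric numerical semigroups with Frobenius number $F$ and type $F-2g$.
   Context: $\mathbb{N}$ is the set of nonnegative integers. A numerical semigroup is a submonoid $S$ of $(\mathbb{N},+)$ with finite complement in $\mathbb{N}$. The genus $\operatorname{g}(S)$ is the cardinality of $\mathbb{N}\setminus S$. The Frobenius number $\operatorname{F}(S)$ is the largest integer not in $S$. For $a,b\in\mathbb{Z}$ write $a\le_S b$ if $b-a\in S$; the set $\operatorname{PF}(S)$ of pseudo-Frobenius numbers is the set of maximal elements of $\mathbb{Z}\setminus S$ with respect to $\le_S$, and the type $\operatorname{t}(S)$ is its cardinality. $S$ is almost symmetric if for every integer $a\notin S$, either $\operatorname{F}(S)-a\in S\setminus\{0\}$ or $a\in\operatorname{PF}(S)$; equivalently, $\operatorname{g}(S)=(\operatorname{F}(S)+\operatorname{t}(S))/2$. For a numerical semigroup $S$ and $s\in\mathbb{Z}$, the $s$-shifted canonical ideal of $S$ is $K_S(s):=\{\operatorname{F}(S)+s-z\mid z\in\mathbb{Z}\setminus S\}$. *)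

theory Defs
  imports Main
begin

text \<open>
  Numerical semigroups are represented as sets of integers contained in \<open>\<nat>\<close>, because Frobenius
  numbers, pseudo-Frobenius numbers and shifted canonical ideals live in the integers.
\<close>

definition numerical_semigroup :: "int set \<Rightarrow> bool" where
  "numerical_semigroup S \<longleftrightarrow>
     S \<subseteq> \<nat> \<and> 0 \<in> S \<and> (\<forall>a\<in>S. \<forall>b\<in>S. a + b \<in> S) \<and> finite (\<nat> - S)"

definition genus :: "int set \<Rightarrow> nat" where
  "genus S = card (\<nat> - S)"

text \<open>The complement is taken in all integers, so the Frobenius number of \<open>\<nat>\<close> is \<open>- 1\<close>.\<close>

definition frobenius_number :: "int set \<Rightarrow> int" where
  "frobenius_number S = (GREATEST z. z \<notin> S)"

definition semigroup_le :: "int set \<Rightarrow> int \<Rightarrow> int \<Rightarrow> bool" where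
  "semigroup_le S a b \<longleftrightarrow> b - a \<in> S"

definition pseudo_frobenius :: "int set \<Rightarrow> int set" where
  "pseudo_frobenius S = {a. a \<notin> S \<and> (\<forall>b. b \<notin> S \<and> semigroup_le S a b \<longrightarrow> b = a)}"

definition semigroup_type :: "int set \<Rightarrow> nat" where
  "semigroup_type S = card (pseudo_frobenius S)"

definition almost_symmetric :: "int set \<Rightarrow> bool" where
  "almost_symmetric S \<longleftrightarrow>
     (\<forall>a. a \<notin> S \<longrightarrow> frobenius_number S - a \<in> S - {0} \<or> a \<in> pseudo_frobenius S)"

definition shifted_canonical_ideal :: "int set \<Rightarrow> int \<Rightarrow> int set" where
  "shifted_canonical_ideal S s = {frobenius_number S + s - z | z. z \<notin> S}"

end

theory Submission
  imports Defs
begin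

text \<open>
  The Frobenius number of \<open>S\<close> cancels in \<open>K\<^sub>S(F - F(S))\<close>, so the correspondence is
  \<open>S \<mapsto> {0} \<union> (F - (\<int> - S))\<close>: reflect the complement of \<open>S\<close> in \<open>F\<close> and adjoin \<open>0\<close>. Its
  inverse is \<open>T \<mapsto> {z. F - z \<notin> T - {0}}\<close>, since \<open>F \<in> S\<close> and hence \<open>0\<close> is never itself the
  reflection of a gap.

  Let \<open>S\<close> have genus \<open>g\<close>. For a gap \<open>x\<close>, at least one element of each pair \<open>i\<close>, \<open>x - i\<close> is a gap,
  so \<open>x \<le> 2g - 1\<close>. Consequently the nonzero elements of the image \<open>T\<close> are at least \<open>F - 2g + 1\<close>,
  and the sum of two of them is at least \<open>2F - 4g + 2 \<ge> F + 1\<close>, hence lies in \<open>T\<close>; this is where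
  \<open>F \<ge> 4g - 1\<close> enters. A gap \<open>a \<noteq> F\<close> of \<open>T\<close> with \<open>F - a \<notin> T - {0}\<close> lies in \<open>S\<close>; for \<open>t \<in> T - {0}\<close>, that
  is \<open>F - t \<notin> S\<close>, additivity of \<open>S\<close> gives \<open>F - (a + t) \<notin> S\<close>, so \<open>a\<close> is pseudo-Frobenius and \<open>T\<close>
  is almost symmetric. Conversely, for an almost symmetric \<open>T\<close> with Frobenius number \<open>F\<close>, almost symmetry is what makes
  the inverse image closed under addition.

  The numerical invariants are matched by a count: if \<open>T\<close> is almost symmetric with Frobenius number
  \<open>F > 0\<close> and \<open>n\<close> elements in \<open>{1..F}\<close>, then \<open>{1..F}\<close> is the disjoint union of these elements, of
  their reflections in \<open>F\<close>, and of the pseudo-Frobenius numbers, so the type is \<open>F - 2n\<close>. The \<open>n\<close>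
  reflections are exactly the gaps of \<open>S\<close>, so \<open>n\<close> is the genus of \<open>S\<close>.
\<close>

section \<open>Numerical semigroups and their gaps\<close>

lemma numerical_semigroup_nonneg: "numerical_semigroup S \<Longrightarrow> x \<in> S \<Longrightarrow> 0 \<le> x"
  by (auto simp: numerical_semigroup_def elim!: Nats_cases)

lemma numerical_semigroup_zero: "numerical_semigroup S \<Longrightarrow> 0 \<in> S"
  by (simp add: numerical_semigroup_def)

lemma numerical_semigroup_add:
  "numerical_semigroup S \<Longrightarrow> x \<in> S \<Longrightarrow> y \<in> S \<Longrightarrow> x + y \<in> S"
  by (simp add: numerical_semigroup_def)

lemma mem_Nats_int_iff: "(x :: int) \<in> \<nat> \<longleftrightarrow> 0 \<le> x"
  by (auto simp: Nats_altdef1)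

lemma frobenius_number_eqI:
  assumes "f \<notin> S" and "\<And>z. f < z \<Longrightarrow> z \<in> S"
  shows "frobenius_number S = f"
  unfolding frobenius_number_def
  using assms by (intro Greatest_equality) (auto simp: not_less[symmetric])

lemma
  assumes "numerical_semigroup S"
  shows frobenius_number_notin: "frobenius_number S \<notin> S"
    and above_frobenius_number: "frobenius_number S < z \<Longrightarrow> z \<in> S"
proof -
  \<comment> \<open>inserting \<open>- 1\<close> covers the case without nonnegative gaps\<close>
  define m where "m = Max (insert (- 1) (\<nat> - S))"
  have fin: "finite (insert (- 1) (\<nat> - S))"
    using assms by (simp add: numerical_semigroup_def)
  have "m \<in> insert (- 1) (\<nat> - S)"
    unfolding m_def using fin by (intro Max_in) auto
  then have notin: "m \<notin> S"
    using numerical_semigroup_nonneg[OF assms, of "- 1"] by auto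
  have above: "z \<in> S" if "m < z" for z
  proof (rule ccontr)
    assume "z \<notin> S"
    have "- 1 \<le> m"
      unfolding m_def using fin by (intro Max_ge) auto
    with that \<open>z \<notin> S\<close> have "z \<in> insert (- 1) (\<nat> - S)"
      by (simp add: mem_Nats_int_iff)
    then have "z \<le> m"
      unfolding m_def using fin by (intro Max_ge)
    with that show False by simp
  qed
  have "frobenius_number S = m"
    using notin above by (rule frobenius_number_eqI)
  then show "frobenius_number S \<notin> S" and "frobenius_number S < z \<Longrightarrow> z \<in> S"
    using notin above by auto
qed

lemma mem_pseudo_frobenius_iff:
  "a \<in> pseudo_frobenius S \<longleftrightarrow> a \<notin> S \<and> (\<forall>s\<in>S. s \<noteq> 0 \<longrightarrow> a + s \<in> S)"
proof -
  have "(\<forall>s\<in>S. s \<noteq> 0 \<longrightarrow> a + s \<in> S) \<longleftrightarrow> (\<forall>b. b - a \<in> S \<longrightarrow> b \<noteq> a \<longrightarrow> b \<in> S)"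
  proof (intro iffI allI ballI impI)
    fix b assume "\<forall>s\<in>S. s \<noteq> 0 \<longrightarrow> a + s \<in> S" "b - a \<in> S" "b \<noteq> a"
    then show "b \<in> S" by (auto dest!: bspec[where x = "b - a"])
  next
    fix s assume "\<forall>b. b - a \<in> S \<longrightarrow> b \<noteq> a \<longrightarrow> b \<in> S" "s \<in> S" "s \<noteq> 0"
    then show "a + s \<in> S" by (auto dest: spec[where x = "a + s"])
  qed
  then show ?thesis
    by (auto simp: pseudo_frobenius_def semigroup_le_def)
qed

lemma gap_less_twice_genus:
  assumes S: "numerical_semigroup S" and "x \<notin> S"
  shows "x < 2 * int (genus S)"
proof (cases "0 \<le> x")
  case True
  let ?G = "\<nat> - S"
  have fin: "finite ?G"
    using S by (simp add: numerical_semigroup_def)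
  have "{0..x} \<subseteq> ?G \<union> (\<lambda>i. x - i) ` ?G"
  proof
    fix i assume i: "i \<in> {0..x}"
    have "i \<notin> S \<or> x - i \<notin> S"
      using numerical_semigroup_add[OF S, of i "x - i"] \<open>x \<notin> S\<close> by auto
    then show "i \<in> ?G \<union> (\<lambda>i. x - i) ` ?G"
    proof
      assume "x - i \<notin> S"
      with i have "x - i \<in> ?G" by (simp add: mem_Nats_int_iff)
      then have "x - (x - i) \<in> (\<lambda>i. x - i) ` ?G" by (rule imageI)
      then show ?thesis by simp
    qed (use i in \<open>simp add: mem_Nats_int_iff\<close>)
  qed
  then have "card {0..x} \<le> card (?G \<union> (\<lambda>i. x - i) ` ?G)"
    using fin by (intro card_mono) auto
  also have "\<dots> \<le> card ?G + card ((\<lambda>i. x - i) ` ?G)"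
    by (rule card_Un_le)
  also have "\<dots> \<le> card ?G + card ?G"
    using card_image_le[OF fin] by simp
  finally show ?thesis
    using True by (simp add: genus_def)
qed simp

section \<open>Reflection of the complement\<close>

text \<open>
  The reflection \<open>{0} \<union> K\<^sub>S(F - F(S))\<close>, written without the Frobenius number of \<open>S\<close>, so that it
  makes sense for every set of integers.
\<close>

definition canonical_reflection :: "int \<Rightarrow> int set \<Rightarrow> int set" where
  "canonical_reflection F S = {x. x = 0 \<or> F - x \<notin> S}"

text \<open>The candidate for the inverse of \<^const>\<open>canonical_reflection\<close>.\<close>

definition inverse_reflection :: "int \<Rightarrow> int set \<Rightarrow> int set" where
  "inverse_reflection F T = {z. F - z \<notin> T - {0}}"

lemma shifted_canonical_ideal_eq_reflection:
  "{0} \<union> shifted_canonical_ideal S (F - frobenius_number S) = canonical_reflection F S"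
proof -
  have "(\<exists>z. x = F - z \<and> z \<notin> S) \<longleftrightarrow> F - x \<notin> S" for x
    by (auto intro: exI[of _ "F - x"])
  then show ?thesis
    by (auto simp: shifted_canonical_ideal_def canonical_reflection_def)
qed

lemma inverse_reflection_canonical_reflection:
  "F \<in> S \<Longrightarrow> inverse_reflection F (canonical_reflection F S) = S"
  by (auto simp: inverse_reflection_def canonical_reflection_def)

lemma canonical_reflection_inverse_reflection:
  "0 \<in> T \<Longrightarrow> canonical_reflection F (inverse_reflection F T) = T"
  by (auto simp: inverse_reflection_def canonical_reflection_def)

lemma genus_inverse_reflection:
  assumes T: "numerical_semigroup T" and F: "frobenius_number T = F"
  shows "genus (inverse_reflection F T) = card (T \<inter> {1..F})"
proof -
  have "bij_betw (\<lambda>z. F - z) (\<nat> - inverse_reflection F T) (T \<inter> {1..F})"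
    by (rule bij_betw_byWitness[where f' = "\<lambda>x. F - x"])
      (use numerical_semigroup_nonneg[OF T] in
        \<open>force simp: inverse_reflection_def mem_Nats_int_iff\<close>)+
  then show ?thesis
    unfolding genus_def by (rule bij_betw_same_card)
qed

section \<open>The type of an almost symmetric semigroup\<close>

text \<open>
  Almost symmetry says that each gap \<open>a\<close> is pseudo-Frobenius or has \<open>F - a \<in> T - {0}\<close>. The two
  alternatives exclude each other: otherwise \<open>F = a + (F - a)\<close> would lie in \<open>T\<close>.
\<close>

lemma almost_symmetric_type:
  assumes T: "numerical_semigroup T" and F: "frobenius_number T = F" and "F > 0"
    and sym: "almost_symmetric T"
  shows "int (semigroup_type T) = F - 2 * int (card (T \<inter> {1..F}))"
proof -
  let ?A = "T \<inter> {1..F}" and ?P = "pseudo_frobenius T"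
  let ?B = "(\<lambda>x. F - x) ` ?A"
  have F_notin: "F \<notin> T" and above: "\<And>z. F < z \<Longrightarrow> z \<in> T"
    using frobenius_number_notin[OF T] above_frobenius_number[OF T] F by auto
  have B_iff: "a \<in> ?B \<longleftrightarrow> F - a \<in> T \<and> 0 \<le> a \<and> a < F" for a
  proof
    assume "F - a \<in> T \<and> 0 \<le> a \<and> a < F"
    then have "F - (F - a) \<in> ?B" by (intro imageI) auto
    then show "a \<in> ?B" by simp
  qed auto
  have B_notin: "a \<notin> T" if "a \<in> ?B" for a
    using that numerical_semigroup_add[OF T, of a "F - a"] F_notin B_iff by auto
  have B_P: "a \<notin> ?P" if "a \<in> ?B" for a
  proof
    assume "a \<in> ?P"
    with that have "a + (F - a) \<in> T"
      unfolding B_iff mem_pseudo_frobenius_iff by force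
    with F_notin show False by simp
  qed
  have P_notin: "a \<notin> T" if "a \<in> ?P" for a
    using that by (simp add: mem_pseudo_frobenius_iff)
  have P_range: "a \<in> {1..F}" if a: "a \<in> ?P" for a
  proof -
    have "a \<noteq> 0"
      using P_notin[OF a] numerical_semigroup_zero[OF T] by auto
    moreover have "a \<le> F"
      using P_notin[OF a] above[of a] by force
    moreover have "\<not> a < 0"
    proof
      assume "a < 0"
      then have "F - a \<in> T" "F - a \<noteq> 0"
        using above \<open>F > 0\<close> by auto
      with a have "a + (F - a) \<in> T"
        unfolding mem_pseudo_frobenius_iff by blast
      with F_notin show False by simp
    qed
    ultimately show ?thesis by auto
  qed
  have "a \<in> ?A \<union> ?B \<union> ?P" if "a \<in> {1..F}" for a
    using that sym unfolding almost_symmetric_def F Un_iff B_iff by force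
  moreover have "a \<in> {1..F}" if "a \<in> ?B" for a
    using that B_notin[OF that] B_iff[of a] numerical_semigroup_zero[OF T]
    by (cases "a = 0") auto
  ultimately have union: "{1..F} = ?A \<union> ?B \<union> ?P"
    using P_range by blast
  have finP: "finite ?P"
    by (rule finite_subset[of _ "{1..F}"]) (use P_range in auto)
  have cardB: "card ?B = card ?A"
    by (intro card_image) (auto simp: inj_on_def)
  have "card {1..F} = card (?A \<union> ?B \<union> ?P)"
    using union by (rule arg_cong)
  also have "\<dots> = card (?A \<union> ?B) + card ?P"
    using finP B_P P_notin by (intro card_Un_disjoint) blast+
  also have "card (?A \<union> ?B) = card ?A + card ?B"
    using B_notin by (intro card_Un_disjoint) blast+
  finally show ?thesis
    using cardB \<open>F > 0\<close> by (simp add: semigroup_type_def)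
qed

section \<open>The correspondence and its inverse\<close>

lemma canonical_reflection_almost_symmetric:
  assumes S: "numerical_semigroup S" and "F > 0" and bound: "F \<ge> 4 * int (genus S) - 1"
  shows "numerical_semigroup (canonical_reflection F S)"
    and "frobenius_number (canonical_reflection F S) = F"
    and "almost_symmetric (canonical_reflection F S)"
proof -
  let ?T = "canonical_reflection F S" and ?g = "int (genus S)"
  have T_iff: "x \<in> ?T \<longleftrightarrow> x = 0 \<or> F - x \<notin> S" for x
    by (simp add: canonical_reflection_def)
  have S_neg: "x \<notin> S" if "x < 0" for x
    using numerical_semigroup_nonneg[OF S, of x] that by auto
  have T_ge: "F - 2 * ?g + 1 \<le> x" if "x \<in> ?T" "x \<noteq> 0" for x
    using gap_less_twice_genus[OF S, of "F - x"] that T_iff by auto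
  have above: "z \<in> ?T" if "F < z" for z
    using that S_neg T_iff by auto
  have F_notin: "F \<notin> ?T"
    using \<open>F > 0\<close> numerical_semigroup_zero[OF S] by (simp add: T_iff)
  then show frob: "frobenius_number ?T = F"
    using above by (rule frobenius_number_eqI)
  have nonneg: "0 \<le> x" if "x \<in> ?T" for x
    using T_ge[OF that] bound \<open>F > 0\<close> by (cases "x = 0") auto
  have "a + b \<in> ?T" if "a \<in> ?T" "b \<in> ?T" for a b
  proof (cases "a = 0 \<or> b = 0")
    case False
    with that have "F < a + b"
      using T_ge[of a] T_ge[of b] bound by auto
    then show ?thesis by (rule above)
  qed (use that in auto)
  moreover have "finite (\<nat> - ?T)"
    by (rule finite_subset[of _ "{0..F}"])
      (use above in \<open>force simp: mem_Nats_int_iff\<close>)+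
  ultimately show "numerical_semigroup ?T"
    using nonneg by (auto simp: numerical_semigroup_def mem_Nats_int_iff T_iff)
  have "a \<in> pseudo_frobenius ?T" if a: "a \<notin> ?T" and "F - a \<notin> ?T - {0}" for a
  proof -
    from a have "F - a \<in> S" by (simp add: T_iff)
    from that have "a = F \<or> a \<in> S" by (auto simp: T_iff)
    have "a + t \<in> ?T" if t: "t \<in> ?T" "t \<noteq> 0" for t
      using \<open>a = F \<or> a \<in> S\<close>
    proof
      assume "a = F"
      with t nonneg[OF t(1)] show ?thesis by (intro above) simp
    next
      assume "a \<in> S"
      then have "F - (a + t) \<notin> S"
        using numerical_semigroup_add[OF S, of a "F - (a + t)"] t by (auto simp: T_iff)
      then show ?thesis by (simp add: T_iff)
    qed
    with a show ?thesis by (simp add: mem_pseudo_frobenius_iff)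
  qed
  then show "almost_symmetric ?T"
    unfolding almost_symmetric_def frob by blast
qed

lemma numerical_semigroup_inverse_reflection:
  assumes T: "numerical_semigroup T" and F: "frobenius_number T = F" and "F > 0"
    and sym: "almost_symmetric T"
  shows "numerical_semigroup (inverse_reflection F T)"
proof -
  let ?S = "inverse_reflection F T"
  have F_notin: "F \<notin> T" and above: "\<And>z. F < z \<Longrightarrow> z \<in> T"
    using frobenius_number_notin[OF T] above_frobenius_number[OF T] F by auto
  have S_iff: "z \<in> ?S \<longleftrightarrow> F - z = 0 \<or> F - z \<notin> T" for z
    by (auto simp: inverse_reflection_def)
  have nonneg: "0 \<le> z" if "z \<in> ?S" for z
    using that above[of "F - z"] \<open>F > 0\<close> by (force simp: S_iff)
  have "a + b \<in> ?S" if ab: "a \<in> ?S" "b \<in> ?S" for a b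
  proof (rule ccontr)
    assume "a + b \<notin> ?S"
    define t where "t = F - (a + b)"
    have t: "t \<in> T" "t \<noteq> 0"
      using \<open>a + b \<notin> ?S\<close> by (auto simp: S_iff t_def)
    have "0 < t"
      using t numerical_semigroup_nonneg[OF T, of t] by simp
    have "a \<noteq> F" "b \<noteq> F"
      using \<open>0 < t\<close> nonneg[OF ab(1)] nonneg[OF ab(2)] by (auto simp: t_def)
    then have "F - a \<notin> T" "F - b \<notin> T"
      using ab by (auto simp: S_iff)
    \<comment> \<open>\<open>F - b = a + t\<close> is a gap, so \<open>a\<close> is neither in \<open>T\<close> nor pseudo-Frobenius; almost symmetry
      then forces \<open>F - a\<close> into \<open>T\<close>\<close>
    then have "a + t \<notin> T" by (simp add: t_def)
    then have "a \<notin> T" "a \<notin> pseudo_frobenius T"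
      using t numerical_semigroup_add[OF T, of a t] by (auto simp: mem_pseudo_frobenius_iff)
    then have "F - a \<in> T"
      using sym F by (auto simp: almost_symmetric_def)
    with \<open>F - a \<notin> T\<close> show False by simp
  qed
  moreover have "finite (\<nat> - ?S)"
    by (rule finite_subset[of _ "{0..F}"])
      (use numerical_semigroup_nonneg[OF T] in \<open>force simp: mem_Nats_int_iff S_iff\<close>)+
  ultimately show ?thesis
    using nonneg F_notin by (auto simp: numerical_semigroup_def mem_Nats_int_iff S_iff)
qed

theorem theorem6:
  fixes F g :: int
  assumes "F > 0" and "g > 0" and "F \<ge> 4 * g - 1"
  shows "bij_betw (\<lambda>S. {0} \<union> shifted_canonical_ideal S (F - frobenius_number S))
           {S. numerical_semigroup S \<and> int (genus S) = g}
           {T. numerical_semigroup T \<and> almost_symmetric T \<and>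
               frobenius_number T = F \<and> int (semigroup_type T) = F - 2 * g}"
  unfolding shifted_canonical_ideal_eq_reflection
proof (rule bij_betw_byWitness[where f' = "inverse_reflection F"])
  let ?A = "{S. numerical_semigroup S \<and> int (genus S) = g}"
  let ?B = "{T. numerical_semigroup T \<and> almost_symmetric T \<and>
               frobenius_number T = F \<and> int (semigroup_type T) = F - 2 * g}"
  have inverse: "inverse_reflection F (canonical_reflection F S) = S" if "S \<in> ?A" for S
  proof (rule inverse_reflection_canonical_reflection)
    \<comment> \<open>\<open>F \<ge> 4g - 1 \<ge> 2g\<close> exceeds every gap of \<open>S\<close>\<close>
    show "F \<in> S"
      using gap_less_twice_genus[of S F] that assms by auto
  qed
  then show "\<forall>S\<in>?A. inverse_reflection F (canonical_reflection F S) = S"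
    by blast
  show "\<forall>T\<in>?B. canonical_reflection F (inverse_reflection F T) = T"
    by (auto intro!: canonical_reflection_inverse_reflection numerical_semigroup_zero)
  have "canonical_reflection F S \<in> ?B" if "S \<in> ?A" for S
  proof -
    let ?T = "canonical_reflection F S"
    have S: "numerical_semigroup S" and g: "int (genus S) = g"
      using that by auto
    have T: "numerical_semigroup ?T" "frobenius_number ?T = F" "almost_symmetric ?T"
      using canonical_reflection_almost_symmetric[OF S] assms g by auto
    have "int (card (?T \<inter> {1..F})) = g"
      using genus_inverse_reflection[OF T(1,2)] inverse[OF that] g by simp
    then show ?thesis
      using T almost_symmetric_type[OF T(1,2) \<open>F > 0\<close> T(3)] by simp
  qed
  then show "canonical_reflection F ` ?A \<subseteq> ?B"
    by blast
  have "inverse_reflection F T \<in> ?A" if "T \<in> ?B" for T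
    using that \<open>F > 0\<close> numerical_semigroup_inverse_reflection[of T F]
      genus_inverse_reflection[of T F] almost_symmetric_type[of T F] by auto
  then show "inverse_reflection F ` ?B \<subseteq> ?A"
    by blast
qed

end
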